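(* Let $A\in\mathbb{R}^{m\times n}$ with $\operatorname{rank}(A)=n$, let $b\in\mathbb{R}^m$, let $R_s\in\mathbb{R}^{n\times n}$ be nonsingular, let $E\in\mathbb{R}^{m\times n}$ and $\epsilon\equiv\|E\|/\|A\|$. Let $A=QR$ be a thin QR factorization and let $x_*\in\mathbb{R}^n$ be the exact solution of the seminormal equations $R^TRx_*=A^Tb$. Let $A+E=\hat Q\hat R$ be a thin QR factorization, where $\hat Q\in\mathbb{R}^{m\times n}$ has orthonormal columns, and let the computed solution $\hat x\in\mathbb{R}^n$ satisfy $$\hat R^T\hat R\hat x=(A+E)^Tb.$$ If $\hat x\neq 0$, then $$\frac{\|\hat x-x_*\|}{\|\hat x\|}\leq \kappa(A)^2\,\epsilon\left(\frac{\|A\hat x-b\|}{\|A\|\,\|\hat x\|}+1+\epsilon\right).$$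
   Context: $\|\cdot\|$ denotes the Euclidean two-norm (for matrices, the induced spectral norm). For a real matrix $M$ of full column rank, $M^\dagger\equiv(M^TM)^{-1}M^T$ is the Moore-Penrose inverse and $\kappa(M)\equiv\|M\|\,\|M^\dagger\|$ is the two-norm condition number with respect to left inversion. A thin QR factorization of an $m\times n$ matrix is a factorization $QR$ where $Q\in\mathbb{R}^{m\times n}$ has orthonormal columns and $R\in\mathbb{R}^{n\times n}$ is upper triangular. No assumption is made on the rank of $A+E$, so $\hat R$ may be singular. *)

theory Defs
  imports "HOL-Analysis.Analysis"
begin

text \<open>
  An m-by-n real matrix has type \<open>real ^ 'n ^ 'm\<close>.  On this type the library's \<open>norm\<close> is the
  Frobenius norm, so the norm induced by the Euclidean norm is defined separately.
\<close>

definition spectral_norm :: "real ^ 'n ^ 'm \<Rightarrow> real" where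
  "spectral_norm M = onorm ((*v) M)"

text \<open>
  Meant for matrices of full column rank only: there the Gram matrix is invertible, so
  \<open>matrix_inv\<close> is its inverse.
\<close>

definition left_pinv :: "real ^ 'n ^ 'm \<Rightarrow> real ^ 'm ^ 'n" where
  "left_pinv M = matrix_inv (transpose M ** M) ** transpose M"

definition cond_num :: "real ^ 'n ^ 'm \<Rightarrow> real" where
  "cond_num M = spectral_norm M * spectral_norm (left_pinv M)"

definition orthonormal_columns :: "real ^ 'n ^ 'm \<Rightarrow> bool" where
  "orthonormal_columns Q \<longleftrightarrow> (\<forall>i j. column i Q \<bullet> column j Q = (if i = j then 1 else 0))"

text \<open>
  The order of the columns matters here, hence the linear order on the index type; up to
  relabelling, such an index type is \<open>{1..n}\<close>.
\<close>

definition upper_triangular :: "real ^ 'n::{finite,linorder} ^ 'n::{finite,linorder} \<Rightarrow> bool" where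
  "upper_triangular R \<longleftrightarrow> (\<forall>i j. j < i \<longrightarrow> R $ i $ j = 0)"

text \<open>The triangular factor may be singular and its diagonal entries may have any sign.\<close>

definition thin_QR ::
    "real ^ 'n::{finite,linorder} ^ 'm \<Rightarrow> real ^ 'n::{finite,linorder} ^ 'm \<Rightarrow> real ^ 'n::{finite,linorder} ^ 'n::{finite,linorder} \<Rightarrow> bool" where
  "thin_QR M Q R \<longleftrightarrow> M = Q ** R \<and> orthonormal_columns Q \<and> upper_triangular R"

end

theory Submission
  imports Defs
begin

text \<open>
  Only the Gram matrices enter: \<open>R\<^sup>T R = A\<^sup>T A\<close> and \<open>R_hat\<^sup>T R_hat = (A + E)\<^sup>T (A + E)\<close>.  Expanding the
  perturbed normal equations gives
  \<open>A\<^sup>T A (x_star - x_hat) = E\<^sup>T (A x_hat - b) + A\<^sup>T E x_hat + E\<^sup>T E x_hat\<close>,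
  and \<open>(A\<^sup>T A)\<^sup>-\<^sup>1 = P P\<^sup>T\<close> for the pseudoinverse \<open>P\<close> of \<open>A\<close>, so the norm of this inverse is at most
  the square of that of \<open>P\<close>.
\<close>

lemma norm_matrix_vector_mult_le:
  fixes M :: "real ^ 'n ^ 'm"
  shows "norm (M *v x) \<le> spectral_norm M * norm x"
  unfolding spectral_norm_def by (rule onorm) (rule matrix_vector_mul_bounded_linear)

lemma spectral_norm_nonneg:
  fixes M :: "real ^ 'n ^ 'm"
  shows "0 \<le> spectral_norm M"
  unfolding spectral_norm_def by (rule onorm_pos_le) (rule matrix_vector_mul_bounded_linear)

text \<open>With \<open>z = transpose M *v y\<close>, moving the transpose across the inner product
  gives \<open>z \<bullet> z = y \<bullet> (M *v z)\<close>. Cauchy-Schwarz bounds this by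
  \<open>norm y * (spectral_norm M * norm z)\<close>, and one factor \<open>norm z\<close> cancels
  when it is nonzero.\<close>

lemma norm_transpose_mult_le:
  fixes M :: "real ^ 'n ^ 'm"
  shows "norm (transpose M *v y) \<le> spectral_norm M * norm y"
proof (cases "transpose M *v y = 0")
  case False
  let ?z = "transpose M *v y"
  have "norm ?z * norm ?z = ?z \<bullet> ?z"
    by (simp add: dot_square_norm power2_eq_square)
  also have "\<dots> = y \<bullet> (M *v ?z)"
    by (simp add: dot_lmul_matrix[symmetric])
  also have "\<dots> \<le> norm y * norm (M *v ?z)"
    by (rule norm_cauchy_schwarz)
  also have "\<dots> \<le> norm y * (spectral_norm M * norm ?z)"
    by (intro mult_left_mono norm_matrix_vector_mult_le) simp
  finally have "norm ?z * norm ?z \<le> (spectral_norm M * norm y) * norm ?z"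
    by (simp add: mult_ac)
  with False show ?thesis
    by (meson mult_right_le_imp_le zero_less_norm_iff)
qed (simp add: spectral_norm_nonneg)

text \<open>The Gram matrix is square, so a trivial kernel suffices; a kernel vector
  \<open>x\<close> has \<open>norm (A *v x) ^ 2 = 0\<close>, hence vanishes by injectivity.\<close>

lemma invertible_gram:
  fixes A :: "real ^ 'n ^ 'm"
  assumes "inj ((*v) A)"
  shows "invertible (transpose A ** A)"
proof -
  have "x = 0" if "(transpose A ** A) *v x = 0" for x
  proof -
    have "norm (A *v x) ^ 2 = x \<bullet> (transpose A *v (A *v x))"
      by (metis dot_lmul_matrix dot_square_norm inner_commute vector_transpose_matrix transpose_transpose)
    also have "\<dots> = 0"
      using that by (simp add: matrix_vector_mul_assoc)
    finally have "A *v x = A *v 0" by simp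
    with assms show "x = 0" by (rule injD)
  qed
  then show ?thesis
    by (simp add: invertible_left_inverse matrix_left_invertible_ker)
qed

text \<open>This form lets an error vector be estimated from its image under the Gram matrix, which
  is what the perturbed equations supply.\<close>

lemma norm_le_left_pinv_gram:
  fixes A :: "real ^ 'n ^ 'm"
  assumes "inj ((*v) A)"
  shows "norm x \<le> (spectral_norm (left_pinv A))\<^sup>2 * norm ((transpose A ** A) *v x)"
proof -
  define G where "G = transpose A ** A"
  define P where "P = left_pinv A"
  have inv: "invertible G"
    using invertible_gram[OF assms] by (simp add: G_def)
  have GG: "matrix_inv G ** G = mat 1"
    using inv unfolding invertible_def matrix_inv_def by (rule someI2_ex) blast
  have P: "P = matrix_inv G ** transpose A"
    by (simp add: P_def left_pinv_def G_def)
  have PA: "P ** A = mat 1"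
    by (simp add: P GG matrix_mul_assoc[symmetric] flip: G_def)
  \<comment> \<open>Transposing \<open>P ** A = mat 1\<close> collapses the tail of \<open>P **
    transpose P = matrix_inv G ** transpose A ** transpose P\<close>.\<close>
  have "transpose A ** transpose P = mat 1"
    using PA by (metis matrix_transpose_mul transpose_mat)
  then have PP: "P ** transpose P = matrix_inv G"
    by (simp add: P matrix_mul_assoc[symmetric])
  have "x = P *v (transpose P *v (G *v x))"
    by (simp add: matrix_vector_mul_assoc PP GG matrix_mul_assoc del: transpose_matrix_vector)
  then have "norm x = norm (P *v (transpose P *v (G *v x)))"
    by simp
  also have "\<dots> \<le> spectral_norm P * norm (transpose P *v (G *v x))"
    by (rule norm_matrix_vector_mult_le)
  also have "\<dots> \<le> spectral_norm P * (spectral_norm P * norm (G *v x))"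
    by (intro mult_left_mono norm_transpose_mult_le spectral_norm_nonneg)
  finally show ?thesis
    by (simp add: power2_eq_square mult_ac P_def G_def)
qed

text \<open>Orthonormality makes \<open>transpose Q ** Q\<close> the identity, so \<open>Q\<close>
  cancels from the Gram matrix of \<open>Q ** R\<close>. This turns both seminormal equations into
  normal equations.\<close>

lemma thin_QR_gram:
  assumes "thin_QR M Q R"
  shows "transpose R ** R = transpose M ** M"
proof -
  have "transpose Q ** Q = mat 1"
    using assms
    by (simp add: thin_QR_def orthonormal_columns_def vec_eq_iff mat_def matrix_mult_transpose_dot_column)
  then have "transpose R ** (transpose Q ** Q) ** R = transpose R ** R"
    by simp
  then show ?thesis
    using assms by (simp add: thin_QR_def matrix_transpose_mul matrix_mul_assoc)
qed

lemma transpose_add: "transpose (A + B) = transpose A + transpose B"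
  by (simp add: transpose_def vec_eq_iff)

theorem theorem5p1:
  fixes A E Q Q_hat :: "real ^ 'n::{finite,linorder} ^ 'm"
    and R_s R R_hat :: "real ^ 'n::{finite,linorder} ^ 'n::{finite,linorder}"
    and b :: "real ^ 'm"
    and x_star x_hat :: "real ^ 'n::{finite,linorder}"
    and \<epsilon> :: real
  assumes "rank A = CARD('n)"
    and "invertible R_s"
    and "\<epsilon> = spectral_norm E / spectral_norm A"
    and "thin_QR A Q R"
    and "(transpose R ** R) *v x_star = transpose A *v b"
    and "thin_QR (A + E) Q_hat R_hat"
    and "(transpose R_hat ** R_hat) *v x_hat = transpose (A + E) *v b"
    and "x_hat \<noteq> 0"
  shows "norm (x_hat - x_star) / norm x_hat
    \<le> (cond_num A)\<^sup>2 * \<epsilon> *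
        (norm (A *v x_hat - b) / (spectral_norm A * norm x_hat) + 1 + \<epsilon>)"
proof -
  define a e p where "a = spectral_norm A" and "e = spectral_norm E"
    and "p = spectral_norm (left_pinv A)"
  define r where "r = A *v x_hat - b"
  have e: "0 \<le> e" by (simp add: e_def spectral_norm_nonneg)
  have inj: "inj ((*v) A)"
    using assms(1) by (simp add: full_rank_injective)
  \<comment> \<open>A nonzero image forces \<open>a > 0\<close>, which the later divisions by
    \<open>a\<close> require.\<close>
  have "A *v x_hat \<noteq> 0"
    using injD[OF inj, of x_hat 0] assms(8) by auto
  then have "0 < a * norm x_hat"
    unfolding a_def by (meson norm_matrix_vector_mult_le less_le_trans zero_less_norm_iff)
  then have a: "0 < a"
    by (simp add: zero_less_mult_iff)
  have x: "0 < norm x_hat"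
    using assms(8) by simp
  have star: "transpose A *v (A *v x_star) = transpose A *v b"
    using assms(5) by (simp add: thin_QR_gram[OF assms(4)] matrix_vector_mul_assoc)
  have hat: "transpose (A + E) *v ((A + E) *v x_hat) = transpose (A + E) *v b"
    using assms(7) by (simp add: thin_QR_gram[OF assms(6)] matrix_vector_mul_assoc)
  \<comment> \<open>By \<open>star\<close> the left side is \<open>- (transpose A *v r)\<close>.
    Since \<open>(A + E) *v x_hat - b = r + E *v x_hat\<close>, expanding \<open>hat\<close>
    expresses this through terms that each contain \<open>E\<close>.\<close>
  have "(transpose A ** A) *v (x_star - x_hat)
      = transpose E *v r + transpose A *v (E *v x_hat) + transpose E *v (E *v x_hat)"
    using star hat
    by (simp add: r_def transpose_add algebra_simps flip: matrix_vector_mul_assoc)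
  \<comment> \<open>The three estimates yield, in order, the residual quotient, the 1 and the
    \<epsilon> in the final bracket.\<close>
  moreover have "norm (transpose E *v r) \<le> e * norm r"
    unfolding e_def by (rule norm_transpose_mult_le)
  moreover have "norm (transpose A *v (E *v x_hat)) \<le> a * (e * norm x_hat)"
    using norm_transpose_mult_le[of A "E *v x_hat"]
      mult_left_mono[OF norm_matrix_vector_mult_le[of E x_hat], of a] a
    unfolding a_def e_def by linarith
  moreover have "norm (transpose E *v (E *v x_hat)) \<le> e * (e * norm x_hat)"
    using norm_transpose_mult_le[of E "E *v x_hat"]
      mult_left_mono[OF norm_matrix_vector_mult_le[of E x_hat], of e] e
    unfolding e_def by linarith
  ultimately have "norm ((transpose A ** A) *v (x_star - x_hat))
      \<le> e * norm r + a * (e * norm x_hat) + e * (e * norm x_hat)"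
    by (smt (verit) norm_triangle_ineq)
  then have "p\<^sup>2 * norm ((transpose A ** A) *v (x_star - x_hat))
      \<le> p\<^sup>2 * (e * norm r + a * (e * norm x_hat) + e * (e * norm x_hat))"
    by (intro mult_left_mono) simp_all
  then have "norm (x_hat - x_star)
      \<le> p\<^sup>2 * (e * norm r + a * (e * norm x_hat) + e * (e * norm x_hat))"
    using norm_le_left_pinv_gram[OF inj, of "x_star - x_hat"]
    by (simp add: p_def norm_minus_commute)
  \<comment> \<open>Pulling out \<open>a * e * norm x_hat\<close> and writing \<open>a * e\<close>
    as \<open>a\<^sup>2 * (e / a)\<close> exposes the condition number \<open>a * p\<close> and the
    relative perturbation \<open>e / a\<close>.\<close>
  also have "\<dots> = (a * p)\<^sup>2 * (e / a) * (norm r / (a * norm x_hat) + 1 + e / a) * norm x_hat"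
    using a x by (simp add: field_simps power2_eq_square)
  finally show ?thesis
    using x by (simp add: pos_divide_le_eq cond_num_def assms(3) a_def e_def p_def r_def)
qed

end
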